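(* Let $F$ be a finite subset of $\mathbb{Z}^d$. Let $v_0,\dots,v_{n-1}\in\mathbb{Z}^d$ be arbitrary, and let $s_0,\dots,s_{n-1}$ be $n$ distinct points in $\mathbb{Z}^k$ such that $S=\{s_j : j=0,1,\ldots,n-1\}$ tiles $\mathbb{Z}^k$ by translations. Define the finite set $$X=\{(v_j,s_j) : j=0,1,\ldots,n-1\}\subseteq\mathbb{Z}^{d+k},$$ and let $F'=\left(F\times\{0\}^k\right)\oplus X\subset\mathbb{Z}^{d+k}$. If $F$ is an aperiodic tile of $\mathbb{Z}^d$, then $F'$ is an aperiodic tile of $\mathbb{Z}^{d+k}$.
   Context: A finite set $F\subset\mathbb{Z}^m$ is a (translational) tile of $\mathbb{Z}^m$, or tiles $\mathbb{Z}^m$ by translations, if there is $A\subset\mathbb{Z}^m$ such that the sets $F+a$, $a\in A$, form a partition of $\mathbb{Z}^m$; such $A$ is called a tiling of $\mathbb{Z}^m$ by $F$. A tiling $A$ of $\mathbb{Z}^m$ is periodic if there is a lattice $\Lambda\subset\mathbb{Z}^m$ (a subgroup containing $m$ linearly independent elements) such that $A+\lambda=A$ for all $\lambda\in\Lambda$. A tile of $\mathbb{Z}^m$ is aperiodic if none of the tilings that it admits are periodic. The notation $B\oplus X$ denotes the Minkowski sum $B+X=\{b+x : b\in B, x\in X\}$ when every element has a unique representation $b+x$; here this holds automatically because the $s_j$ are distinct. *)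

theory Defs
  imports "HOL-Analysis.Analysis"
begin

text \<open>
  The group \<open>\<int>\<^sup>m\<close> is the type \<^typ>\<open>int ^ 'm\<close> with \<open>m = CARD('m)\<close>. Sums of sets of
  vectors are the Minkowski sums of \<^theory>\<open>HOL-Library.Set_Algebras\<close>.
\<close>

definition tiling :: "(int ^ 'm) set \<Rightarrow> (int ^ 'm) set \<Rightarrow> bool" where
  "tiling F A \<longleftrightarrow>
     disjoint_family_on (\<lambda>a. (\<lambda>x. x + a) ` F) A \<and> (\<Union>a\<in>A. (\<lambda>x. x + a) ` F) = UNIV"

definition tile :: "(int ^ 'm) set \<Rightarrow> bool" where
  "tile F \<longleftrightarrow> finite F \<and> (\<exists>A. tiling F A)"

text \<open>
  Linear independence below is independence over \<open>\<int>\<close> in the module \<open>\<int>\<^sup>m\<close>, which for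
  integer vectors is the same as independence over \<open>\<rat>\<close> or \<open>\<real>\<close>.
\<close>

lemma module_int_vec: "module ((*s) :: int \<Rightarrow> int ^ 'm \<Rightarrow> int ^ 'm)"
  by unfold_locales (auto simp: vec_eq_iff algebra_simps)

definition lattice_in :: "(int ^ 'm) set \<Rightarrow> bool" where
  "lattice_in L \<longleftrightarrow>
     0 \<in> L \<and> (\<forall>x\<in>L. \<forall>y\<in>L. x + y \<in> L) \<and> (\<forall>x\<in>L. - x \<in> L) \<and>
     (\<exists>B\<subseteq>L. finite B \<and> card B = CARD('m) \<and> \<not> module.dependent (*s) B)"

definition periodic :: "(int ^ 'm) set \<Rightarrow> bool" where
  "periodic A \<longleftrightarrow> (\<exists>L. lattice_in L \<and> (\<forall>l\<in>L. (\<lambda>a. a + l) ` A = A))"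

definition aperiodic_tile :: "(int ^ 'm) set \<Rightarrow> bool" where
  "aperiodic_tile F \<longleftrightarrow> tile F \<and> (\<forall>A. tiling F A \<longrightarrow> \<not> periodic A)"

text \<open>
  The point \<open>(x, y)\<close> of \<open>\<int>\<^sup>d\<^sup>+\<^sup>k\<close>, for \<open>x \<in> \<int>\<^sup>d\<close> and \<open>y \<in> \<int>\<^sup>k\<close>. The coordinates of
  \<open>\<int>\<^sup>d\<^sup>+\<^sup>k\<close> are indexed by the sum type, and \<open>CARD('d + 'k) = CARD('d) + CARD('k)\<close>.
\<close>

definition vec_append :: "int ^ 'd \<Rightarrow> int ^ 'k \<Rightarrow> int ^ ('d + 'k)" where
  "vec_append x y = (\<chi> i. case i of Inl a \<Rightarrow> x $ a | Inr b \<Rightarrow> y $ b)"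

lemma vec_append_add: "vec_append x y + vec_append x' y' = vec_append (x + x') (y + y')"
  by (auto simp: vec_append_def vec_eq_iff split: sum.split)

lemma vec_append_eq_iff: "vec_append x y = vec_append x' y' \<longleftrightarrow> x = x' \<and> y = y'"
proof
  assume *: "vec_append x y = vec_append x' y'"
  have "x $ a = x' $ a" for a
    using arg_cong[OF *, of "\<lambda>z. z $ Inl a"] by (simp add: vec_append_def)
  moreover have "y $ b = y' $ b" for b
    using arg_cong[OF *, of "\<lambda>z. z $ Inr b"] by (simp add: vec_append_def)
  ultimately show "x = x' \<and> y = y'" by (simp add: vec_eq_iff)
qed simp

text \<open>
  When the \<open>s j\<close> are distinct, the Minkowski sum of \<open>F \<times> {0}\<close> and the set of the points
  \<open>(v j, s j)\<close> is direct, i.e. it is the sum written with \<open>\<oplus>\<close>.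
\<close>

lemma sum_direct:
  fixes v :: "nat \<Rightarrow> int ^ 'd" and s :: "nat \<Rightarrow> int ^ 'k"
  assumes "inj_on s {..<n}"
  shows "inj_on (\<lambda>(b, x). b + x)
           ({vec_append f 0 | f. f \<in> F} \<times> {vec_append (v j) (s j) | j. j < n})"
proof (rule inj_onI, clarify)
  fix f j f' j'
  assume j: "j < n" "j' < n"
    and eq: "vec_append f 0 + vec_append (v j) (s j) = vec_append f' 0 + vec_append (v j') (s j')"
  then have "s j = s j'" and *: "f + v j = f' + v j'"
    by (simp_all add: vec_append_add vec_append_eq_iff)
  with j assms have "j = j'" by (auto dest: inj_onD)
  with * show "vec_append f (0 :: int ^ 'k) = vec_append f' 0 \<and>
      vec_append (v j) (s j) = vec_append (v j') (s j')" by simp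
qed

end

theory Submission
  imports Defs
begin

text \<open>
  Products of tilings show that \<open>F'\<close> is a tile. Conversely, a tiling of \<open>\<int>\<^sup>d\<^sup>+\<^sup>k\<close> by \<open>F'\<close>
  restricts to a tiling of the slice \<open>\<int>\<^sup>d \<times> {0}\<close> by translates of \<open>F\<close>, which is invariant
  under every period of the form \<open>(l, 0)\<close>. A full-rank lattice contains a nonzero multiple of
  every integer vector, so the periods of this form are again a full-rank lattice, and a
  periodic tiling by \<open>F'\<close> would give a periodic tiling by \<open>F\<close>.
\<close>

interpretation int_vec: module "(*s) :: int \<Rightarrow> int ^ 'm \<Rightarrow> int ^ 'm"
  by (rule module_int_vec)

section \<open>Tilings in pointwise form\<close>

text \<open>The translate of \<open>F\<close> by \<open>a\<close> contains \<open>x\<close> exactly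
  when \<open>x - a \<in> F\<close>. So existence of \<open>a\<close> is the covering property and
  its uniqueness is disjointness; every later argument about tilings uses this form.\<close>

lemma tiling_iff: "tiling F A \<longleftrightarrow> (\<forall>x. \<exists>!a. a \<in> A \<and> x - a \<in> F)"
proof -
  have img: "(\<lambda>y. y + a) ` F = {x. x - a \<in> F}" for a
    by (auto simp: image_iff) (metis diff_add_cancel)
  have "disjoint_family_on (\<lambda>a. {x. x - a \<in> F}) A \<longleftrightarrow>
      (\<forall>x. \<forall>a\<in>A. \<forall>b\<in>A. x - a \<in> F \<longrightarrow> x - b \<in> F \<longrightarrow> a = b)"
    unfolding disjoint_family_on_def by blast
  moreover have "(\<Union>a\<in>A. {x. x - a \<in> F}) = UNIV \<longleftrightarrow> (\<forall>x. \<exists>a\<in>A. x - a \<in> F)"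
    by auto
  ultimately have "tiling F A \<longleftrightarrow>
      (\<forall>x. (\<exists>a\<in>A. x - a \<in> F) \<and> (\<forall>a\<in>A. \<forall>b\<in>A. x - a \<in> F \<longrightarrow> x - b \<in> F \<longrightarrow> a = b))"
    unfolding tiling_def img by (simp add: all_conj_distrib conj_commute)
  also have "\<dots> \<longleftrightarrow> (\<forall>x. \<exists>!a. a \<in> A \<and> x - a \<in> F)"
    by (intro all_cong1) blast
  finally show ?thesis .
qed

lemma tilingE:
  assumes "tiling F A"
  obtains a where "a \<in> A" "x - a \<in> F" "\<forall>a'\<in>A. x - a' \<in> F \<longrightarrow> a' = a"
  using assms unfolding tiling_iff by metis

section \<open>Linear dependence over the integers and full-rank lattices\<close>

text \<open>A product of denominators of the finitely many values serves as \<open>D\<close>. This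
  turns a rational linear relation into an integral one.\<close>

lemma common_denominator:
  fixes u :: "'a \<Rightarrow> rat"
  assumes "finite S"
  obtains D :: int and w :: "'a \<Rightarrow> int"
  where "D \<noteq> 0" "\<And>x. x \<in> S \<Longrightarrow> of_int (w x) = of_int D * u x"
proof -
  have "\<exists>D::int. D \<noteq> 0 \<and> (\<forall>x\<in>S. of_int D * u x \<in> \<int>)"
    using assms
  proof (induction S)
    case empty
    show ?case by (auto intro: exI[of _ 1])
  next
    case (insert x S)
    then obtain D :: int where D: "D \<noteq> 0" "\<forall>y\<in>S. of_int D * u y \<in> \<int>" by auto
    obtain p q :: int where q: "u x = of_int p / of_int q" "q \<noteq> 0"
      by (metis Fract_of_int_quotient Rat_cases not_less_iff_gr_or_eq)
    have "of_int (D * q) * u x = of_int (D * p)"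
      using q by simp
    then have "of_int (D * q) * u x \<in> \<int>"
      by (metis Ints_of_int)
    moreover have "of_int (D * q) * u y \<in> \<int>" if "y \<in> S" for y
    proof -
      have "of_int (D * q) * u y = of_int q * (of_int D * u y)" by simp
      then show ?thesis using D that by (metis Ints_mult Ints_of_int)
    qed
    ultimately show ?case
      using D q by (intro exI[of _ "D * q"]) auto
  qed
  then obtain D :: int where D: "D \<noteq> 0" "\<forall>x\<in>S. of_int D * u x \<in> \<int>" by auto
  then have "\<forall>x\<in>S. \<exists>z::int. of_int z = of_int D * u x"
    by (metis Ints_cases)
  then obtain w :: "'a \<Rightarrow> int" where "\<forall>x\<in>S. of_int (w x) = of_int D * u x"
    by metis
  with D that show ?thesis by blast
qed

text \<open>The vectors are viewed in a rational vector space of dimension \<open>CARD('m)\<close>,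
  where so many of them satisfy a nontrivial relation; clearing denominators brings the relation
  back to integer coefficients.\<close>

lemma int_vec_dependent:
  fixes S :: "(int ^ 'm) set"
  assumes "finite S" "card S > CARD('m)"
  shows "int_vec.dependent S"
proof -
  define g :: "int ^ 'm \<Rightarrow> rat ^ 'm" where "g x = (\<chi> i. of_int (x $ i))" for x
  have inj: "inj_on g S"
    by (auto simp: g_def inj_on_def vec_eq_iff)
  have "vec.dependent (g ` S)"
  proof (rule ccontr)
    assume "\<not> vec.dependent (g ` S)"
    then have "card (g ` S) \<le> CARD('m)"
      using vec.independent_card_le_dim[of "g ` S" UNIV] by (simp add: vec.dim_UNIV card_cart_basis)
    with assms show False by (simp add: card_image[OF inj])
  qed
  then obtain u where u: "\<exists>y\<in>g ` S. u y \<noteq> 0" "(\<Sum>y\<in>g ` S. u y *s y) = 0"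
    using vec.dependent_finite[of "g ` S"] assms(1) by auto
  obtain D w where D: "D \<noteq> 0" "\<And>x. x \<in> S \<Longrightarrow> rat_of_int (w x) = of_int D * u (g x)"
    using common_denominator[OF assms(1), of "u \<circ> g"] by auto
  have "(\<Sum>x\<in>S. w x *s x) $ i = 0" for i
  proof -
    have "rat_of_int ((\<Sum>x\<in>S. w x *s x) $ i) = (\<Sum>x\<in>S. of_int (w x) * g x $ i)"
      by (simp add: g_def)
    also have "\<dots> = (\<Sum>x\<in>S. of_int D * (u (g x) * g x $ i))"
      by (intro sum.cong) (simp_all add: D)
    also have "\<dots> = of_int D * (\<Sum>y\<in>g ` S. u y *s y) $ i"
      by (simp add: sum.reindex[OF inj] sum_distrib_left)
    also have "\<dots> = 0" by (simp only: u(2) zero_index mult_zero_right)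
    finally show ?thesis by (simp only: of_int_eq_0_iff)
  qed
  then have "(\<Sum>x\<in>S. w x *s x) = 0" by (simp add: vec_eq_iff)
  \<comment> \<open>Since \<open>D \<noteq> 0\<close>, scaling by \<open>D\<close> keeps a nonzero
    coefficient nonzero.\<close>
  moreover have "\<exists>x\<in>S. w x \<noteq> 0"
  proof -
    obtain x where x: "x \<in> S" "u (g x) \<noteq> 0" using u(1) by blast
    with D have "rat_of_int (w x) \<noteq> 0" by simp
    with x show ?thesis by auto
  qed
  ultimately show ?thesis
    unfolding int_vec.dependent_explicit using assms(1) by blast
qed

lemma int_scale_closed:
  fixes L :: "(int ^ 'm) set"
  assumes "0 \<in> L" "\<And>x y. x \<in> L \<Longrightarrow> y \<in> L \<Longrightarrow> x + y \<in> L" "\<And>x. x \<in> L \<Longrightarrow> - x \<in> L" "x \<in> L"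
  shows "c *s x \<in> L"
proof (induction c rule: int_induct[where k = 0])
  case base
  show ?case using assms by simp
next
  case (step1 i)
  then show ?case using assms by (simp add: int_vec.scale_left_distrib)
next
  case (step2 i)
  then have "i *s x + - x \<in> L" using assms by blast
  then show ?case by (simp add: int_vec.scale_left_diff_distrib)
qed

text \<open>Full rank is restated without choosing an independent set, because such a set in
  \<open>L\<close> need not meet a given slice, whereas multiples of a vector of the slice stay in
  it.\<close>

lemma lattice_in_iff:
  fixes L :: "(int ^ 'm) set"
  shows "lattice_in L \<longleftrightarrow>
     0 \<in> L \<and> (\<forall>x\<in>L. \<forall>y\<in>L. x + y \<in> L) \<and> (\<forall>x\<in>L. - x \<in> L) \<and> (\<forall>x. \<exists>c. c \<noteq> 0 \<and> c *s x \<in> L)"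
proof -
  have "(\<exists>B\<subseteq>L. finite B \<and> card B = CARD('m) \<and> \<not> int_vec.dependent B) \<longleftrightarrow>
      (\<forall>x. \<exists>c. c \<noteq> 0 \<and> c *s x \<in> L)"
    if L: "0 \<in> L" "\<And>x y. x \<in> L \<Longrightarrow> y \<in> L \<Longrightarrow> x + y \<in> L" "\<And>x. x \<in> L \<Longrightarrow> - x \<in> L"
  proof
    assume "\<exists>B\<subseteq>L. finite B \<and> card B = CARD('m) \<and> \<not> int_vec.dependent B"
    then obtain B where B: "B \<subseteq> L" "finite B" "card B = CARD('m)" "\<not> int_vec.dependent B"
      by blast
    show "\<forall>x. \<exists>c. c \<noteq> 0 \<and> c *s x \<in> L"
    proof
      fix x
      show "\<exists>c. c \<noteq> 0 \<and> c *s x \<in> L"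
      proof (cases "x \<in> B")
        case True
        with B show ?thesis by (intro exI[of _ 1]) auto
      next
        case False
        \<comment> \<open>The set now has one element more than the rank. In the resulting relation
          the coefficient of \<open>x\<close> is the desired multiplier.\<close>
        with B have "int_vec.dependent (insert x B)"
          by (intro int_vec_dependent) auto
        then obtain t u where t: "finite t" "t \<subseteq> insert x B" "(\<Sum>y\<in>t. u y *s y) = 0"
            "\<exists>y\<in>t. u y \<noteq> 0"
          unfolding int_vec.dependent_explicit by blast
        \<comment> \<open>Otherwise the relation would involve only elements of the independent set
          \<open>B\<close>.\<close>
        have *: "x \<in> t \<and> u x \<noteq> 0"
        proof (rule ccontr)
          assume n: "\<not> (x \<in> t \<and> u x \<noteq> 0)"
          then have "(\<Sum>y\<in>t - {x}. u y *s y) = 0"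
            using t by (cases "x \<in> t") (auto simp: sum.remove)
          moreover have "\<exists>y\<in>t - {x}. u y \<noteq> 0" "t - {x} \<subseteq> B" "finite (t - {x})"
            using n t by auto
          ultimately show False
            using B(4) unfolding int_vec.dependent_explicit by blast
        qed
        have sub: "t - {x} \<subseteq> L" using t B by auto
        have "(\<Sum>y\<in>r. u y *s y) \<in> L" if "finite r" "r \<subseteq> L" for r
          using that by (induction r) (auto intro!: L int_scale_closed[of L])
        then have "(\<Sum>y\<in>t - {x}. u y *s y) \<in> L"
          using t sub by blast
        moreover have "u x *s x = - (\<Sum>y\<in>t - {x}. u y *s y)"
          using t * by (simp add: sum.remove[of t x] add_eq_0_iff2)
        ultimately show ?thesis using L * by metis
      qed
    qed
  next
    assume "\<forall>x. \<exists>c. c \<noteq> 0 \<and> c *s x \<in> L"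
    then have "\<forall>i. \<exists>c. c \<noteq> 0 \<and> c *s axis i 1 \<in> L" by blast
    then obtain c where c: "\<And>i. c i \<noteq> 0" "\<And>i. c i *s axis i 1 \<in> L" by metis
    \<comment> \<open>Nonzero multiples of the standard unit vectors that lie in \<open>L\<close>.
      They form a diagonal system, so coordinate \<open>i\<close> of a relation isolates the
      coefficient of \<open>b i\<close>.\<close>
    define b :: "'m \<Rightarrow> int ^ 'm" where "b i = c i *s axis i 1" for i
    have b: "b i $ j = (if j = i then c i else 0)" for i j
      by (simp add: b_def axis_def)
    have inj: "inj b"
      by (metis b c(1) injI)
    have "\<not> int_vec.dependent (range b)"
    proof
      assume "int_vec.dependent (range b)"
      then obtain t u where t: "finite t" "t \<subseteq> range b" "(\<Sum>y\<in>t. u y *s y) = 0"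
          "\<exists>y\<in>t. u y \<noteq> 0"
        unfolding int_vec.dependent_explicit by blast
      then obtain i where i: "b i \<in> t" "u (b i) \<noteq> 0" by auto
      have "(\<Sum>y\<in>t. u y *s y) $ i = (\<Sum>y\<in>t. if y = b i then u y * c i else 0)"
        unfolding sum_component
      proof (rule sum.cong)
        fix y assume "y \<in> t"
        with t obtain j where "y = b j" by auto
        then show "(u y *s y) $ i = (if y = b i then u y * c i else 0)"
          using injD[OF inj] by (auto simp: b)
      qed simp
      also have "\<dots> = u (b i) * c i"
        using t i by (simp add: sum.delta)
      finally show False using t i c by simp
    qed
    moreover have "card (range b) = CARD('m)"
      by (rule card_image[OF inj])
    moreover have "range b \<subseteq> L"
      using c by (auto simp: b_def)
    ultimately show "\<exists>B\<subseteq>L. finite B \<and> card B = CARD('m) \<and> \<not> int_vec.dependent B"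
      by (intro exI[of _ "range b"]) auto
  qed
  then show ?thesis unfolding lattice_in_def by (intro conj_cong refl) auto
qed

section \<open>Product coordinates and slices of lattices\<close>

lemma vec_append_cases:
  obtains x y where "z = vec_append x y"
proof
  show "z = vec_append (\<chi> a. z $ Inl a) (\<chi> b. z $ Inr b)"
    by (auto simp: vec_append_def vec_eq_iff split: sum.split)
qed

lemma vec_append_diff: "vec_append x y - vec_append x' y' = vec_append (x - x') (y - y')"
  by (auto simp: vec_append_def vec_eq_iff split: sum.split)

lemma vec_append_uminus: "- vec_append x y = vec_append (- x) (- y)"
  by (auto simp: vec_append_def vec_eq_iff split: sum.split)

lemma vec_append_scale: "c *s vec_append x y = vec_append (c *s x) (c *s y)"
  by (auto simp: vec_append_def vec_eq_iff split: sum.split)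

lemma vec_append_0: "vec_append 0 0 = 0"
  by (auto simp: vec_append_def vec_eq_iff split: sum.split)

text \<open>If \<open>c\<close> times the vector \<open>(x, 0)\<close> lies in \<open>L\<close>,
  this multiple is \<open>(c *s x, 0)\<close> and is again in the slice, so the criterion by
  multiples passes from \<open>L\<close> to the slice.\<close>

lemma lattice_in_slice:
  fixes L :: "(int ^ ('d::finite + 'k::finite)) set"
  assumes "lattice_in L"
  shows "lattice_in {l :: int ^ 'd. vec_append l (0 :: int ^ 'k) \<in> L}"
proof -
  note L = assms[unfolded lattice_in_iff]
  have "\<exists>c. c \<noteq> 0 \<and> vec_append (c *s x) (0 :: int ^ 'k) \<in> L" for x :: "int ^ 'd"
    using L by (metis vec_append_scale int_vec.scale_zero_right)
  moreover have "vec_append (x + y) (0 :: int ^ 'k) \<in> L"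
    if "vec_append x (0 :: int ^ 'k) \<in> L" "vec_append y (0 :: int ^ 'k) \<in> L" for x y :: "int ^ 'd"
    using L that by (metis vec_append_add add_0)
  moreover have "vec_append (- x) (0 :: int ^ 'k) \<in> L"
    if "vec_append x (0 :: int ^ 'k) \<in> L" for x :: "int ^ 'd"
    using L that by (metis vec_append_uminus minus_zero)
  ultimately show ?thesis
    using L unfolding lattice_in_iff by (simp add: vec_append_0)
qed

text \<open>This describes the sum fibrewise: over \<open>s j\<close> it contains the translate of
  \<open>F\<close> by \<open>v j\<close>, and over points that are no \<open>s j\<close> it is
  empty.\<close>

lemma vec_append_mem_sum:
  "vec_append x y \<in> {vec_append f 0 | f. f \<in> F} + {vec_append (v j) (s j) | j. j < n} \<longleftrightarrow>
    (\<exists>j<n. y = s j \<and> x - v j \<in> F)"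
proof
  assume "vec_append x y \<in> {vec_append f 0 | f. f \<in> F} + {vec_append (v j) (s j) | j. j < n}"
  then show "\<exists>j<n. y = s j \<and> x - v j \<in> F"
    by (auto elim!: set_plus_elim simp: vec_append_add vec_append_eq_iff)
next
  assume "\<exists>j<n. y = s j \<and> x - v j \<in> F"
  then obtain j where j: "j < n" "y = s j" "x - v j \<in> F" by blast
  then have "vec_append x y = vec_append (x - v j) 0 + vec_append (v j) (s j)"
    by (simp add: vec_append_add)
  then show "vec_append x y \<in> {vec_append f 0 | f. f \<in> F} + {vec_append (v j) (s j) | j. j < n}"
    using j by (metis (mono_tags, lifting) mem_Collect_eq set_plus_intro)
qed

section \<open>Tilings of the product and of the slice\<close>

text \<open>For a point \<open>(x, y)\<close>, the tiling \<open>T\<close> determines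
  \<open>t\<close> and, as the \<open>s j\<close> are distinct, the index \<open>j\<close> with
  \<open>y - t = s j\<close>. The tiling \<open>A\<close> then determines \<open>a\<close> from the
  shifted point \<open>x - v j\<close>, whatever \<open>v j\<close> is.\<close>

lemma tiling_product:
  fixes F :: "(int ^ 'd) set" and s :: "nat \<Rightarrow> int ^ 'k"
  assumes inj: "inj_on s {..<n}"
    and T: "tiling {s j | j. j < n} T"
    and A: "tiling F A"
  shows "tiling ({vec_append f 0 | f. f \<in> F} + {vec_append (v j) (s j) | j. j < n})
           {vec_append a t | a t. a \<in> A \<and> t \<in> T}"
  unfolding tiling_iff
proof
  fix z :: "int ^ ('d + 'k)"
  obtain x y where z: "z = vec_append x y" by (rule vec_append_cases)
  obtain t where t: "t \<in> T" "y - t \<in> {s j | j. j < n}"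
    and t_uniq: "\<forall>t'\<in>T. y - t' \<in> {s j | j. j < n} \<longrightarrow> t' = t"
    by (rule tilingE[OF T, where x = y])
  then obtain j where j: "j < n" "y - t = s j" by blast
  obtain a where a: "a \<in> A" "x - v j - a \<in> F"
    and a_uniq: "\<forall>a'\<in>A. x - v j - a' \<in> F \<longrightarrow> a' = a"
    by (rule tilingE[OF A, where x = "x - v j"])
  show "\<exists>!w. w \<in> {vec_append a t | a t. a \<in> A \<and> t \<in> T} \<and>
      z - w \<in> {vec_append f 0 | f. f \<in> F} + {vec_append (v j) (s j) | j. j < n}"
  proof (rule ex1I[of _ "vec_append a t"])
    have "x - a - v j \<in> F" using a by (simp add: algebra_simps)
    then show "vec_append a t \<in> {vec_append a t | a t. a \<in> A \<and> t \<in> T} \<and>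
      z - vec_append a t \<in> {vec_append f 0 | f. f \<in> F} + {vec_append (v j) (s j) | j. j < n}"
      using a t j unfolding z vec_append_diff vec_append_mem_sum by blast
  next
    fix w
    assume w: "w \<in> {vec_append a t | a t. a \<in> A \<and> t \<in> T} \<and>
      z - w \<in> {vec_append f 0 | f. f \<in> F} + {vec_append (v j) (s j) | j. j < n}"
    then obtain a' t' where w': "w = vec_append a' t'" "a' \<in> A" "t' \<in> T" by blast
    with w obtain i where i: "i < n" "y - t' = s i" "x - a' - v i \<in> F"
      unfolding z w' vec_append_diff vec_append_mem_sum by blast
    then have "t' = t" using t_uniq w' by blast
    \<comment> \<open>Equal indices mean equal shifts, so the uniqueness of \<open>a\<close> for the
      point \<open>x - v j\<close> applies.\<close>
    with i j inj have "i = j" by (auto dest: inj_onD)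
    with i have "x - v j - a' \<in> F" by (simp add: algebra_simps)
    then show "w = vec_append a t" using w' \<open>t' = t\<close> a_uniq by blast
  qed
qed

text \<open>The translate of the sum by \<open>(b, t)\<close> meets the slice of second coordinate 0
  only if \<open>- t = s j\<close> for some \<open>j\<close>, and then in the translate of
  \<open>F\<close> by \<open>b + v j\<close>. Writing \<open>a = b + v j\<close> gives
  \<open>b = a - v j\<close> and \<open>t = - s j\<close>, hence the form of the set.\<close>

lemma tiling_slice:
  fixes F :: "(int ^ 'd) set" and s :: "nat \<Rightarrow> int ^ 'k"
  assumes inj: "inj_on s {..<n}"
    and A: "tiling ({vec_append f 0 | f. f \<in> F} + {vec_append (v j) (s j) | j. j < n}) A"
  shows "tiling F {a. \<exists>j<n. vec_append (a - v j) (- s j) \<in> A}"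
  unfolding tiling_iff
proof
  fix x
  obtain w where w: "w \<in> A" "vec_append x 0 - w \<in>
      {vec_append f 0 | f. f \<in> F} + {vec_append (v j) (s j) | j. j < n}"
    and w_uniq: "\<forall>w'\<in>A. vec_append x 0 - w' \<in>
      {vec_append f 0 | f. f \<in> F} + {vec_append (v j) (s j) | j. j < n} \<longrightarrow> w' = w"
    by (rule tilingE[OF A, where x = "vec_append x 0"])
  obtain b t where bt: "w = vec_append b t" by (rule vec_append_cases)
  with w obtain j where j: "j < n" "- t = s j" "x - b - v j \<in> F"
    unfolding bt vec_append_diff vec_append_mem_sum by auto
  show "\<exists>!a. a \<in> {a. \<exists>j<n. vec_append (a - v j) (- s j) \<in> A} \<and> x - a \<in> F"
  proof (rule ex1I[of _ "b + v j"])
    have "vec_append (b + v j - v j) (- s j) \<in> A"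
      using w bt j by (simp flip: j(2))
    then show "b + v j \<in> {a. \<exists>j<n. vec_append (a - v j) (- s j) \<in> A} \<and> x - (b + v j) \<in> F"
      using j by (auto simp: algebra_simps)
  next
    fix a
    assume "a \<in> {a. \<exists>j<n. vec_append (a - v j) (- s j) \<in> A} \<and> x - a \<in> F"
    then obtain i where i: "i < n" "vec_append (a - v i) (- s i) \<in> A" "x - a \<in> F" by blast
    \<comment> \<open>Both translates of the sum cover the point \<open>(x, 0)\<close>.\<close>
    have "vec_append (a - v i) (- s i) = w"
      by (rule w_uniq[rule_format]) (use i in \<open>auto simp: vec_append_diff vec_append_mem_sum intro!: exI[of _ i]\<close>)
    then have ab: "a - v i = b" and "s i = s j"
      using j(2) by (auto simp: bt vec_append_eq_iff)
    then have "i = j" using inj i(1) j(1) by (simp add: inj_on_eq_iff)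
    with ab show "a = b + v j" by (simp add: algebra_simps)
  qed
qed

text \<open>Adding a period \<open>(l, 0)\<close> to \<open>(a - v j, - s j)\<close> keeps
  \<open>j\<close> and moves \<open>a\<close> to \<open>a + l\<close>. Hence the slice of the period
  lattice of \<open>A\<close> consists of periods of the sliced tiling.\<close>

lemma periodic_slice:
  fixes A :: "(int ^ ('d::finite + 'k::finite)) set" and v :: "nat \<Rightarrow> int ^ 'd" and s :: "nat \<Rightarrow> int ^ 'k"
  assumes "periodic A"
  shows "periodic {a. \<exists>j<n. vec_append (a - v j) (- s j) \<in> A}"
proof -
  obtain L where L: "lattice_in L" "\<And>l. l \<in> L \<Longrightarrow> (\<lambda>a. a + l) ` A = A"
    using assms unfolding periodic_def by blast
  have closed: "a + l \<in> A" if "a \<in> A" "l \<in> L" for a l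
    using L(2) that by blast
  define P where "P = {a. \<exists>j<n. vec_append (a - v j) (- s j) \<in> A}"
  have P: "a + l \<in> P" if a: "a \<in> P" and l: "vec_append l (0 :: int ^ 'k) \<in> L" for a l
  proof -
    obtain j where "j < n" "vec_append (a - v j) (- s j) \<in> A"
      using a unfolding P_def by blast
    with closed[OF this(2) l] show ?thesis
      unfolding P_def vec_append_add by (auto simp: algebra_simps)
  qed
  have "(\<lambda>a. a + l) ` P = P" if l: "vec_append l (0 :: int ^ 'k) \<in> L" for l
  proof -
    \<comment> \<open>Translation by \<open>- l\<close> also maps \<open>P\<close> into itself,
      which upgrades the inclusion to equality.\<close>
    have "vec_append (- l) (0 :: int ^ 'k) \<in> L"
      using lattice_in_slice[OF L(1)] l unfolding lattice_in_def by blast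
    then have "a = (a - l) + l \<and> a - l \<in> P" if "a \<in> P" for a
      using P[OF that, of "- l"] by simp
    then show ?thesis using P l by blast
  qed
  then show ?thesis
    using lattice_in_slice[OF L(1)] unfolding periodic_def P_def by blast
qed

theorem theorem2p1:
  fixes F :: "(int ^ 'd) set"
    and v :: "nat \<Rightarrow> int ^ 'd"
    and s :: "nat \<Rightarrow> int ^ 'k"
    and n :: nat
  assumes "finite F"
    and "inj_on s {..<n}"
    and "tile {s j | j. j < n}"
    and "aperiodic_tile F"
  shows "aperiodic_tile
           ({vec_append f 0 | f. f \<in> F} + {vec_append (v j) (s j) | j. j < n})"
proof -
  have "finite ({vec_append f (0 :: int ^ 'k) | f. f \<in> F} + {vec_append (v j) (s j) | j. j < n})"
    using assms(1) by (intro finite_set_plus) auto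
  moreover obtain T A where "tiling {s j | j. j < n} T" "tiling F A"
    using assms(3,4) unfolding aperiodic_tile_def tile_def by blast
  ultimately show ?thesis
    using tiling_product[OF assms(2)] tiling_slice[OF assms(2)] periodic_slice assms(4)
    unfolding aperiodic_tile_def tile_def by blast
qed

end
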